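(* Let $N \ge 1$ be an integer and let $\mathcal{A} \subseteq U(N)$ be a finite subset of cardinality $|\mathcal{A}| \ge 2$. If $$\delta(\mathcal{A}) = \min\big\{\varphi(A B^{-1}) : A \in \mathcal{A},\ B \in \mathcal{A},\ \text{and } A \ne B\big\},$$ then $$\delta(\mathcal{A}) \le 2\pi\, |\mathcal{A}|^{-1/N^2}.$$
   Context: $U(N)$ is the group of $N \times N$ complex unitary matrices. For a (column) vector $\boldsymbol{x} \in \mathbb{C}^N$, $|\boldsymbol{x}|_2 = (|x_1|^2 + \cdots + |x_N|^2)^{1/2}$ is the standard Hermitian norm, and $X = \{\boldsymbol{x} \in \mathbb{C}^N : |\boldsymbol{x}|_2 = 1\}$. The function $\varphi : U(N) \to [0,\infty)$ is defined by $\varphi(A) = \sup\{|A\boldsymbol{x} - \boldsymbol{x}|_2 : \boldsymbol{x} \in X\}$. *)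

theory Defs
  imports "HOL-Analysis.Analysis"
begin

definition adjoint_matrix :: "complex^'n^'m \<Rightarrow> complex^'m^'n"
  where "adjoint_matrix A = map_matrix cnj (transpose A)"

definition unitary_group :: "(complex^'n^'n) set"
  where "unitary_group =
    {A. adjoint_matrix A ** A = mat 1 \<and> A ** adjoint_matrix A = mat 1}"

(* The norm of complex^'n is the Hermitian norm sqrt (\<Sum>i. |x i|^2), so sphere 0 1 is the
   complex unit sphere.  The supremum is over a nonempty set of reals bounded above. *)
definition phi :: "complex^'n^'n \<Rightarrow> real"
  where "phi A = (SUP x\<in>sphere 0 1. norm (A *v x - x))"

(* Min is only meaningful if S is finite with at least two elements. *)
definition min_separation :: "(complex^'n^'n) set \<Rightarrow> real"
  where "min_separation S = Min {phi (A ** matrix_inv B) | A B. A \<in> S \<and> B \<in> S \<and> A \<noteq> B}"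

end

theory Submission
  imports Defs "HOL-Computational_Algebra.Fundamental_Theorem_Algebra"
begin

text \<open>The bound comes from comparing the volume of \<open>U(N)\<close> with that of a neighbourhood of the identity,
but volumes are replaced here by cardinalities of separated sets.

Every unitary matrix is \<open>V diag(cis \<theta>) V\<^sup>*\<close> with \<open>V\<close> unitary and \<open>|\<theta>\<^sub>i| \<le> \<pi>\<close> (\<open>unitary_spectral\<close>). For
\<open>0 < c < 1\<close> let \<open>g\<close> replace \<open>\<theta>\<close> by \<open>c \<theta>\<close>. Then \<open>g(U)\<close> is within \<open>\<pi> c\<close> of the identity in the operator
norm, and \<open>g\<close> shrinks distances by no more than the factor \<open>c\<close> in the Frobenius norm
(\<open>unitary_shrinking\<close>). The latter holds because the squared Frobenius distance of two diagonalised
matrices is a sum of \<open>|d\<^sub>i - e\<^sub>j|\<^sup>2\<close> over their eigenvalues with nonnegative weights that depend only on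
the eigenvectors (\<open>norm_conjugate_diagonal_diff\<close>), so that a statement about points of the unit
circle suffices.

Suppose that the elements of \<open>S\<close> have pairwise distance more than \<open>2 \<pi> c\<close>. If \<open>E\<close> is an
\<open>\<epsilon>\<close>-separated set of unitary matrices with \<open>\<epsilon>\<close> small, then the products \<open>A g(U)\<close> with \<open>A \<in> S\<close> and
\<open>U \<in> E\<close> form a \<open>c \<epsilon>\<close>-separated set with \<open>|S| |E|\<close> elements. Iterating this from a single point
gives \<open>|S|\<^sup>k\<close> unitary matrices with separation \<open>\<eta> c\<^sup>k\<close>, where \<open>\<eta>\<close> is independent of \<open>k\<close>
(\<open>separated_products\<close>). On the other hand \<open>U(N)\<close> has real dimension \<open>N\<^sup>2\<close>, so an \<open>\<epsilon>\<close>-separated subset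
has at most a constant times \<open>\<epsilon>\<close> to the power \<open>- N\<^sup>2\<close> elements (\<open>card_separated_unitary_le\<close>). For
large \<open>k\<close> the two estimates are compatible only if \<open>|S|\<close> times the \<open>N\<^sup>2\<close>-th power of \<open>c\<close> is at most \<open>1\<close>
(\<open>card_mult_power_le_1\<close>). Letting \<open>2 \<pi> c\<close> approach the minimal separation of \<open>S\<close> gives the theorem.\<close>

section \<open>The spectral theorem for unitary matrices\<close>

lemma adjoint_matrix_nth [simp]: "adjoint_matrix A $ i $ j = cnj (A $ j $ i)"
  by (simp add: adjoint_matrix_def map_matrix_def transpose_def)

lemma adjoint_matrix_mult: "adjoint_matrix (A ** B) = adjoint_matrix B ** adjoint_matrix A"
  by (simp add: vec_eq_iff matrix_matrix_mult_def mult.commute)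

lemma adjoint_matrix_adjoint [simp]: "adjoint_matrix (adjoint_matrix A) = A"
  by (simp add: vec_eq_iff)

lemma adjoint_unitary: "U \<in> unitary_group \<Longrightarrow> adjoint_matrix U \<in> unitary_group"
  by (simp add: unitary_group_def)

lemma unitary_mult:
  assumes "U \<in> unitary_group" "V \<in> unitary_group"
  shows "U ** V \<in> unitary_group"
proof -
  have "adjoint_matrix V ** adjoint_matrix U ** (U ** V)
      = adjoint_matrix V ** (adjoint_matrix U ** U) ** V"
    "U ** V ** (adjoint_matrix V ** adjoint_matrix U)
      = U ** (V ** adjoint_matrix V) ** adjoint_matrix U"
    by (simp_all add: matrix_mul_assoc)
  then show ?thesis
    using assms by (simp add: unitary_group_def adjoint_matrix_mult)
qed

definition herm :: "complex^'n \<Rightarrow> complex^'n \<Rightarrow> complex"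
  where "herm x y = (\<Sum>i\<in>UNIV. cnj (x $ i) * y $ i)"

lemma herm_self: "herm x x = of_real ((norm x)\<^sup>2)"
  by (simp add: herm_def norm_vec_def L2_set_def sum_nonneg complex_norm_square mult.commute
      del: of_real_power)

lemma herm_commute: "herm y x = cnj (herm x y)"
  by (simp add: herm_def mult.commute)

lemma herm_scale_right: "herm x (c *s y) = c * herm x y"
  by (simp add: herm_def sum_distrib_left mult_ac)

lemma herm_scale_left: "herm (c *s x) y = cnj c * herm x y"
  by (simp add: herm_def sum_distrib_left mult_ac)

lemma herm_add_right: "herm x (y + z) = herm x y + herm x z"
  by (simp add: herm_def sum.distrib algebra_simps)

lemma herm_adjoint: "herm (A *v x) y = herm x (adjoint_matrix A *v y)"
proof -
  have "herm (A *v x) y = (\<Sum>i\<in>UNIV. \<Sum>j\<in>UNIV. cnj (A $ i $ j) * cnj (x $ j) * y $ i)"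
    by (simp add: herm_def matrix_vector_mult_def sum_distrib_right)
  also have "\<dots> = (\<Sum>j\<in>UNIV. \<Sum>i\<in>UNIV. cnj (A $ i $ j) * cnj (x $ j) * y $ i)"
    by (rule sum.swap)
  also have "\<dots> = herm x (adjoint_matrix A *v y)"
    by (simp add: herm_def matrix_vector_mult_def sum_distrib_left mult_ac)
  finally show ?thesis .
qed

lemma norm_unitary_mult_vec:
  assumes "U \<in> unitary_group"
  shows "norm (U *v x) = norm x"
proof -
  have "herm (U *v x) (U *v x) = herm x x"
    using assms by (simp add: herm_adjoint matrix_vector_mul_assoc unitary_group_def)
  then have "(norm (U *v x))\<^sup>2 = (norm x)\<^sup>2"
    unfolding herm_self of_real_eq_iff .
  then show ?thesis by simp
qed

text \<open>The vector \<open>p(A) v\<close>, by Horner's scheme, so that no polynomial algebra over matrices is involved.\<close>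

definition poly_action :: "complex^'n^'n \<Rightarrow> complex poly \<Rightarrow> complex^'n \<Rightarrow> complex^'n"
  where "poly_action A p v = fold_coeffs (\<lambda>c w. c *s v + A *v w) p 0"

lemma poly_action_0 [simp]: "poly_action A 0 v = 0"
  by (simp add: poly_action_def)

lemma poly_action_pCons [simp]:
  "poly_action A (pCons c p) v = c *s v + A *v poly_action A p v"
  by (cases "p = 0 \<and> c = 0") (auto simp add: poly_action_def fold_coeffs_pCons_eq)

lemma mult_vec_scale: "A *v (c *s x) = c *s (A *v x)" for A :: "complex^'n^'m"
  by (simp add: vec.scale)

lemma poly_action_add: "poly_action A (p + q) v = poly_action A p v + poly_action A q v"
proof (induction p arbitrary: q)
  case (pCons a p)
  obtain b r where "q = pCons b r" by (cases q)
  with pCons show ?case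
    by (simp add: vector_sadd_rdistrib matrix_vector_right_distrib)
qed simp

lemma poly_action_smult: "poly_action A (smult c p) v = c *s poly_action A p v"
  by (induction p) (simp_all add: vector_add_ldistrib mult_vec_scale vector_smult_assoc)

lemma poly_action_linear_factor:
  "poly_action A ([:- z, 1:] * p) v = poly_action A p (A *v v - z *s v)"
proof -
  have *: "A *v poly_action A p v = poly_action A p (A *v v)" for v
    by (induction p) (simp_all add: matrix_vector_right_distrib mult_vec_scale)
  have **: "poly_action A p (v - w) = poly_action A p v - poly_action A p w" for v w
    by (induction p)
       (simp_all add: matrix_vector_mult_diff_distrib vector_ssub_ldistrib)
  have ***: "poly_action A p (c *s v) = c *s poly_action A p v" for c v
    by (induction p)
       (simp_all add: vector_add_ldistrib mult_vec_scale vector_smult_assoc mult.commute)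
  have "poly_action A ([:- z, 1:] * p) v = A *v poly_action A p v - z *s poly_action A p v"
    using poly_action_add[of A "pCons 0 p" "smult (- z) p" v]
      poly_action_smult[of A "- z" p v]
    by simp
  then show ?thesis by (simp add: * ** ***)
qed

lemma poly_action_monom: "poly_action A (monom c k) v = c *s (((*v) A ^^ k) v)"
  by (induction k) (simp_all add: monom_0 monom_Suc mult_vec_scale)

text \<open>The \<open>n + 1\<close> vectors \<open>v, A v, \<dots>, A\<^sup>n v\<close> of an \<open>n\<close>-dimensional space are linearly dependent.\<close>

lemma annihilating_poly:
  fixes A :: "complex^'n^'n"
  obtains p where "p \<noteq> 0" "poly_action A p v = 0"
proof -
  define f where "f k = ((*v) A ^^ k) v" for k
  show ?thesis
  proof (cases "inj_on f {..CARD('n)}")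
    case False
    then obtain i j where ij: "i \<noteq> j" "f i = f j" by (auto simp: inj_on_def)
    have "coeff (monom 1 i + monom (-1 :: complex) j) i = 1"
      using ij by simp
    then have "monom 1 i + monom (-1 :: complex) j \<noteq> 0"
      by (metis coeff_0 zero_neq_one)
    moreover have "poly_action A (monom 1 i + monom (-1) j) v = 0"
      using ij by (simp add: poly_action_add poly_action_monom f_def)
    ultimately show ?thesis by (rule that)
  next
    case True
    have "card (f ` {..CARD('n)}) = Suc CARD('n)"
      using True by (simp add: card_image)
    then have "vec.dependent (f ` {..CARD('n)})"
      using vec.independent_card_le_dim[of "f ` {..CARD('n)}" UNIV]
      by (auto simp: vec_dim_card simp del: vec.dim_UNIV)
    then obtain u k where u: "k \<le> CARD('n)" "u (f k) \<noteq> 0"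
      "(\<Sum>w\<in>f ` {..CARD('n)}. u w *s w) = 0"
      by (auto simp: vec.dependent_finite)
    define p where "p = (\<Sum>i\<le>CARD('n). monom (u (f i)) i)"
    have "coeff p k = (\<Sum>i\<le>CARD('n). if i = k then u (f i) else 0)"
      by (simp add: p_def coeff_sum)
    also have "\<dots> = u (f k)"
      using u(1) by simp
    finally have "p \<noteq> 0" using u(2) by auto
    moreover have "poly_action A (\<Sum>i\<in>I. monom (u (f i)) i) v = (\<Sum>i\<in>I. u (f i) *s f i)"
      if "finite I" for I
      using that by (induction I) (simp_all add: poly_action_add poly_action_monom f_def)
    then have "poly_action A p v = 0"
      using u(3) True by (simp add: p_def sum.reindex)
    ultimately show ?thesis by (rule that)
  qed
qed

text \<open>Split the annihilating polynomial of a vector into linear factors \<open>A - z\<close> and apply them one by one.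
All intermediate vectors stay in the invariant subspace, and the last one that does not vanish is
an eigenvector. Working with a single vector avoids restricting \<open>A\<close> to a space of another
dimension, which would be another type.\<close>

lemma invariant_subspace_eigenvector:
  fixes A :: "complex^'n^'n"
  assumes sub: "vec.subspace W" and inv: "\<And>x. x \<in> W \<Longrightarrow> A *v x \<in> W"
    and v: "v \<in> W" "v \<noteq> 0"
  obtains x z where "x \<in> W" "x \<noteq> 0" "A *v x = z *s x"
proof -
  obtain p where "p \<noteq> 0" "poly_action A p v = 0"
    using annihilating_poly .
  then have "\<exists>x z. x \<in> W \<and> x \<noteq> 0 \<and> A *v x = z *s x"
    using v
  proof (induction "degree p" arbitrary: p v)
    case 0
    then obtain c where "p = [:c:]" by (metis degree_eq_zeroE)
    with 0 show ?case by (auto simp: vec_eq_iff)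
  next
    case (Suc n)
    then obtain z where "poly p z = 0"
      using fundamental_theorem_of_algebra[of p] by (auto simp: constant_degree)
    then obtain q where q: "p = [:- z, 1:] * q"
      by (auto simp: poly_eq_0_iff_dvd elim: dvdE)
    show ?case
    proof (cases "A *v v = z *s v")
      case True
      with Suc.prems show ?thesis by blast
    next
      case False
      have "q \<noteq> 0" using Suc.prems(1) q by auto
      then have "degree p = Suc (degree q)"
        unfolding q by (subst degree_mult_eq) auto
      moreover have "poly_action A q (A *v v - z *s v) = 0"
        using Suc.prems(2) unfolding q poly_action_linear_factor .
      moreover have "A *v v - z *s v \<in> W"
        using Suc.prems(3) sub inv by (intro vec.subspace_diff vec.subspace_scale)
      ultimately show ?thesis
        using Suc.hyps(1)[of q "A *v v - z *s v"] Suc.hyps(2) \<open>q \<noteq> 0\<close> False by simp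
    qed
  qed
  then show ?thesis using that by blast
qed

text \<open>The matrix with rows \<open>b\<^sub>i\<^sup>*\<close> for \<open>i \<in> I\<close> and zero rows elsewhere is singular.\<close>

lemma nonzero_orthogonal_vector:
  fixes b :: "'n::finite \<Rightarrow> complex^'n"
  assumes "I \<noteq> UNIV"
  obtains v where "v \<noteq> 0" "\<And>i. i \<in> I \<Longrightarrow> herm (b i) v = 0"
proof -
  define M :: "complex^'n^'n" where "M = (\<chi> i j. if i \<in> I then cnj (b i $ j) else 0)"
  obtain k where "k \<notin> I" using assms by blast
  then have "row k M = 0" by (simp add: row_def M_def vec_eq_iff)
  then have "det M = 0" by (rule det_zero_row)
  then have "\<not> invertible M" by (simp add: invertible_det_nz)
  then obtain v where v: "M *v v = 0" "v \<noteq> 0"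
    using matrix_left_invertible_ker[of M] invertible_left_inverse[of M] by blast
  moreover have "herm (b i) v = (M *v v) $ i" if "i \<in> I" for i
    using that by (simp add: herm_def matrix_vector_mult_def M_def)
  ultimately show ?thesis using that by simp
qed

text \<open>An orthonormal family of eigenvectors is extended one index at a time. The orthogonal complement
\<open>W\<close> of the eigenvectors found so far is invariant because \<open>A\<close> is unitary, hence contains a
further eigenvector.\<close>

lemma unitary_orthonormal_eigenvectors:
  fixes A :: "complex^'n^'n"
  assumes A: "A \<in> unitary_group"
  shows "\<exists>b (z :: 'n \<Rightarrow> complex). (\<forall>i. A *v b i = z i *s b i) \<and>
    (\<forall>i j. herm (b i) (b j) = (if i = j then 1 else 0))"
proof -
  have "\<exists>b (z :: 'n \<Rightarrow> complex). \<forall>i\<in>I. A *v b i = z i *s b i \<and> 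
          (\<forall>j\<in>I. herm (b i) (b j) = (if i = j then 1 else 0))"
    if "finite I" for I :: "'n set"
    using that
  proof (induction I)
    case (insert k I)
    then obtain b z where bz: "\<And>i. i \<in> I \<Longrightarrow> A *v b i = z i *s b i"
      "\<And>i j. i \<in> I \<Longrightarrow> j \<in> I \<Longrightarrow> herm (b i) (b j) = (if i = j then 1 else 0)"
      by blast
    define W where "W = {x. \<forall>i\<in>I. herm (b i) x = 0}"
    have sub: "vec.subspace W"
      unfolding vec.subspace_def W_def
      by (auto simp: herm_add_right herm_scale_right) (simp add: herm_def)
    have inv: "A *v x \<in> W" if "x \<in> W" for x
    proof -
      have "herm (b i) (A *v x) = 0" if "i \<in> I" for i
      proof -
        \<comment> \<open>The inner product with \<open>A b\<^sub>i = z\<^sub>i b\<^sub>i\<close> is preserved by \<open>A\<close>, and \<open>z\<^sub>i \<noteq> 0\<close>.\<close>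
        have "z i * cnj (herm (A *v x) (b i)) = 0"
        proof -
          have "z i * herm (A *v x) (b i) = herm (A *v x) (A *v b i)"
            using bz(1)[OF \<open>i \<in> I\<close>] by (simp add: herm_scale_right)
          also have "\<dots> = herm x (b i)"
            using A by (simp add: herm_adjoint matrix_vector_mul_assoc unitary_group_def)
          also have "\<dots> = 0"
            using \<open>x \<in> W\<close> \<open>i \<in> I\<close> by (subst herm_commute) (simp add: W_def)
          finally show ?thesis by simp
        qed
        moreover have "z i \<noteq> 0"
        proof
          assume "z i = 0"
          then have "norm (A *v b i) = 0" using bz(1)[OF \<open>i \<in> I\<close>] by simp
          then have "b i = 0" using A by (simp add: norm_unitary_mult_vec)
          then show False using bz(2)[OF \<open>i \<in> I\<close> \<open>i \<in> I\<close>] by (simp add: herm_def)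
        qed
        ultimately show ?thesis by (subst herm_commute) simp
      qed
      then show ?thesis by (simp add: W_def)
    qed
    have "I \<noteq> UNIV" using insert.hyps by auto
    then obtain v where "v \<noteq> 0" "\<And>i. i \<in> I \<Longrightarrow> herm (b i) v = 0"
      using nonzero_orthogonal_vector[of I b] by blast
    then have "v \<in> W" "v \<noteq> 0" by (simp_all add: W_def)
    from invariant_subspace_eigenvector[OF sub inv this]
    obtain x c where x: "x \<in> W" "x \<noteq> 0" "A *v x = c *s x" .
    define y where "y = complex_of_real (1 / norm x) *s x"
    have "herm y y = of_real (1 / norm x) * (of_real (1 / norm x) * herm x x)"
      unfolding y_def herm_scale_left herm_scale_right by simp
    then have "herm y y = 1"
      unfolding herm_self using x(2) by (simp add: power2_eq_square)
    moreover have "herm (b i) y = 0" "herm y (b i) = 0" if "i \<in> I" for i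
      using x(1) that herm_commute[of "b i" x]
      by (simp_all add: y_def herm_scale_left herm_scale_right W_def)
    moreover have "A *v y = c *s y"
      using x(3) by (simp add: y_def mult_vec_scale vector_smult_assoc mult.commute)
    ultimately show ?case
      using bz insert.hyps(2)
      by (intro exI[of _ "b(k := y)"] exI[of _ "z(k := c)"]) auto
  qed simp
  from this[of UNIV] obtain b and z :: "'n \<Rightarrow> complex" where "\<forall>i\<in>UNIV. A *v b i = z i *s b i \<and>
      (\<forall>j\<in>UNIV. herm (b i) (b j) = (if i = j then 1 else 0))"
    by auto
  then show ?thesis by (intro exI[of _ b] exI[of _ z]) blast
qed

definition diagonal :: "('n \<Rightarrow> complex) \<Rightarrow> complex^'n^'n"
  where "diagonal d = (\<chi> i j. if i = j then d i else 0)"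

lemma diagonal_mult_nth: "(diagonal d ** A) $ i $ j = d i * A $ i $ j"
  by (simp add: matrix_matrix_mult_def diagonal_def if_distrib[of "\<lambda>x. x * _"] cong: if_cong)

lemma mult_diagonal_nth: "(A ** diagonal d) $ i $ j = A $ i $ j * d j"
  by (simp add: matrix_matrix_mult_def diagonal_def if_distrib[of "\<lambda>x. _ * x"] cong: if_cong)

definition conjugate_diagonal :: "complex^'n^'n \<Rightarrow> ('n \<Rightarrow> complex) \<Rightarrow> complex^'n^'n"
  where "conjugate_diagonal V d = V ** diagonal d ** adjoint_matrix V"

lemma unitary_spectral:
  fixes U :: "complex^'n^'n"
  assumes U: "U \<in> unitary_group"
  obtains V \<theta> where "V \<in> unitary_group" "\<And>i. \<bar>\<theta> i\<bar> \<le> pi"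
    "U = conjugate_diagonal V (\<lambda>i. cis (\<theta> i))"
proof -
  obtain b :: "'n \<Rightarrow> complex^'n" and z :: "'n \<Rightarrow> complex"
    where b: "\<And>i. U *v b i = z i *s b i"
      "\<And>i j. herm (b i) (b j) = (if i = j then 1 else 0)"
    using unitary_orthonormal_eigenvectors[OF U] by metis
  define V :: "complex^'n^'n" where "V = (\<chi> i j. b j $ i)"
  have "adjoint_matrix V ** V = mat 1"
    using b(2) unfolding herm_def by (simp add: vec_eq_iff matrix_matrix_mult_def V_def mat_def)
  moreover from this have "V ** adjoint_matrix V = mat 1"
    using matrix_left_right_inverse by blast
  ultimately have V: "V \<in> unitary_group"
    by (simp add: unitary_group_def)
  have "(U ** V) $ i $ j = (U *v b j) $ i" for i j
    by (simp add: matrix_matrix_mult_def matrix_vector_mult_def V_def)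
  then have "U ** V = V ** diagonal z"
    by (simp add: vec_eq_iff mult_diagonal_nth b(1)) (simp add: V_def mult.commute)
  then have "conjugate_diagonal V z = U ** (V ** adjoint_matrix V)"
    by (simp add: conjugate_diagonal_def matrix_mul_assoc)
  then have "U = conjugate_diagonal V z"
    using V by (simp add: unitary_group_def)
  moreover have "cis (Arg (z i)) = z i" for i
  proof -
    have "(norm (b i))\<^sup>2 = 1"
      using b(2)[of i i] unfolding herm_self if_P[OF refl] of_real_eq_1_iff .
    moreover have "norm (z i *s b i) = norm (b i)"
      using norm_unitary_mult_vec[OF U, of "b i"] b(1) by simp
    moreover have "norm (z i *s b i) = cmod (z i) * norm (b i)"
      by (simp add: norm_vec_def norm_mult L2_set_right_distrib)
    ultimately have "cmod (z i) = 1" by (auto simp: power2_eq_1_iff)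
    then show ?thesis
      using cis_Arg[of "z i"] by (cases "z i = 0") (simp_all add: sgn_eq)
  qed
  ultimately have "U = conjugate_diagonal V (\<lambda>i. cis (Arg (z i)))"
    by simp
  moreover have "\<bar>Arg (z i)\<bar> \<le> pi" for i
    using Arg_le_pi[of "z i"] mpi_less_Arg[of "z i"] by linarith
  ultimately show ?thesis using V by (intro that[of V "\<lambda>i. Arg (z i)"])
qed

section \<open>The Frobenius norm and functions of unitary matrices\<close>

text \<open>The norm of the type of matrices is the Frobenius norm. Unlike the operator norm it behaves well
under arbitrary functions of the eigenvalues, as the next lemmas show.\<close>

lemma norm_matrix_squared: "(norm A)\<^sup>2 = (\<Sum>i\<in>UNIV. \<Sum>j\<in>UNIV. (cmod (A $ i $ j))\<^sup>2)"
  by (simp add: norm_vec_def L2_set_def sum_nonneg)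

lemma norm_adjoint: "norm (adjoint_matrix A) = norm A"
proof -
  have "(norm (adjoint_matrix A))\<^sup>2 = (norm A)\<^sup>2"
    unfolding norm_matrix_squared by (subst sum.swap) simp
  then show ?thesis by simp
qed

lemma norm_unitary_mult_left:
  assumes "U \<in> unitary_group"
  shows "norm (U ** A) = norm A"
proof -
  have *: "(norm B)\<^sup>2 = (\<Sum>j\<in>UNIV. (norm (column j B))\<^sup>2)" for B :: "complex^'b^'a"
    unfolding norm_matrix_squared
    by (subst sum.swap) (simp add: norm_vec_def L2_set_def sum_nonneg column_def)
  have "column j (U ** A) = U *v column j A" for j
    by (simp add: column_def vec_eq_iff matrix_matrix_mult_def matrix_vector_mult_def)
  then have "(norm (U ** A))\<^sup>2 = (norm A)\<^sup>2"
    using assms by (simp add: * norm_unitary_mult_vec)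
  then show ?thesis by simp
qed

lemma norm_unitary_mult_right:
  assumes "U \<in> unitary_group"
  shows "norm (A ** U) = norm A"
proof -
  have "norm (A ** U) = norm (adjoint_matrix U ** adjoint_matrix A)"
    by (metis adjoint_matrix_mult norm_adjoint)
  also have "\<dots> = norm A"
    using adjoint_unitary[OF assms] by (simp add: norm_unitary_mult_left norm_adjoint)
  finally show ?thesis .
qed

lemma norm_matrix_mult_vec_le: "norm (A *v x) \<le> norm A * norm x" for A :: "complex^'n^'m"
proof -
  have "norm ((A *v x) $ i) \<le> norm (A $ i) * norm x" for i
  proof -
    have "norm ((A *v x) $ i) \<le> (\<Sum>j\<in>UNIV. \<bar>cmod (A $ i $ j)\<bar> * \<bar>cmod (x $ j)\<bar>)"
      by (simp add: matrix_vector_mult_def order_trans[OF norm_sum] norm_mult)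
    also have "\<dots> \<le> norm (A $ i) * norm x"
      unfolding norm_vec_def by (rule L2_set_mult_ineq)
    finally show ?thesis .
  qed
  then have "norm (A *v x) \<le> L2_set (\<lambda>i. norm (A $ i) * norm x) UNIV"
    unfolding norm_vec_def[of "A *v x"] by (intro L2_set_mono) auto
  also have "\<dots> = norm A * norm x"
    by (simp add: norm_vec_def[of A] L2_set_left_distrib)
  finally show ?thesis .
qed

text \<open>By unitary invariance the difference \<open>V D V\<^sup>* - W E W\<^sup>*\<close> has the norm of \<open>D Q - Q E\<close> with
\<open>Q = V\<^sup>* W\<close>, whose entries are \<open>(d\<^sub>i - e\<^sub>j) Q\<^sub>i\<^sub>j\<close>. The weights \<open>|Q\<^sub>i\<^sub>j|\<^sup>2\<close> do not depend on the
eigenvalues.\<close>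

lemma norm_conjugate_diagonal_diff:
  fixes V W :: "complex^'n^'n"
  assumes V: "V \<in> unitary_group" and W: "W \<in> unitary_group"
  shows "(norm (conjugate_diagonal V d - conjugate_diagonal W e))\<^sup>2 =
    (\<Sum>i\<in>UNIV. \<Sum>j\<in>UNIV. (cmod (d i - e j))\<^sup>2 * (cmod ((adjoint_matrix V ** W) $ i $ j))\<^sup>2)"
proof -
  let ?Q = "adjoint_matrix V ** W"
  have "conjugate_diagonal V d - conjugate_diagonal W e =
      V ** (diagonal d ** ?Q - ?Q ** diagonal e) ** adjoint_matrix W"
  proof -
    have distrib: "V ** (X - Y) ** Z = V ** X ** Z - V ** Y ** Z" for X Y Z :: "complex^'n^'n"
      by (simp add: vec_eq_iff matrix_matrix_mult_def algebra_simps sum_subtractf)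
    have "V ** (diagonal d ** ?Q) ** adjoint_matrix W
        = V ** diagonal d ** adjoint_matrix V ** (W ** adjoint_matrix W)"
      "V ** (?Q ** diagonal e) ** adjoint_matrix W
        = (V ** adjoint_matrix V) ** W ** diagonal e ** adjoint_matrix W"
      by (simp_all only: matrix_mul_assoc)
    then show ?thesis
      using V W unfolding distrib by (simp add: conjugate_diagonal_def unitary_group_def)
  qed
  then have "norm (conjugate_diagonal V d - conjugate_diagonal W e)
      = norm (diagonal d ** ?Q - ?Q ** diagonal e)"
    using V adjoint_unitary[OF W]
    by (simp add: norm_unitary_mult_left norm_unitary_mult_right)
  moreover have "(diagonal d ** ?Q - ?Q ** diagonal e) $ i $ j = (d i - e j) * ?Q $ i $ j" for i j
    by (simp add: diagonal_mult_nth mult_diagonal_nth algebra_simps)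
  ultimately show ?thesis
    by (simp only: norm_matrix_squared norm_mult power_mult_distrib)
qed

text \<open>A function on the spectra that expands distances by at least the factor \<open>c\<close> does the same on
matrices, because it does so for every term of the preceding formula.\<close>

lemma norm_conjugate_diagonal_diff_mono:
  assumes V: "V \<in> unitary_group" and W: "W \<in> unitary_group" and "0 \<le> c"
    and le: "\<And>i j. c * cmod (d i - e j) \<le> cmod (d' i - e' j)"
  shows "c * norm (conjugate_diagonal V d - conjugate_diagonal W e)
    \<le> norm (conjugate_diagonal V d' - conjugate_diagonal W e')"
proof -
  have *: "c\<^sup>2 * (cmod (d i - e j))\<^sup>2 \<le> (cmod (d' i - e' j))\<^sup>2" for i j
    using power_mono[OF le[of i j], of 2] \<open>0 \<le> c\<close> by (simp add: power_mult_distrib)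
  have "(c * norm (conjugate_diagonal V d - conjugate_diagonal W e))\<^sup>2
    \<le> (norm (conjugate_diagonal V d' - conjugate_diagonal W e'))\<^sup>2"
    unfolding power_mult_distrib norm_conjugate_diagonal_diff[OF V W] sum_distrib_left
      mult.assoc[symmetric]
    by (intro sum_mono mult_right_mono *) simp
  then show ?thesis by (rule power2_le_imp_le) simp
qed

lemma conjugate_diagonal_unitary:
  assumes V: "V \<in> unitary_group" and d: "\<And>i. cmod (d i) = 1"
  shows "conjugate_diagonal V d \<in> unitary_group"
proof -
  have "cnj (d i) * d i = 1" "d i * cnj (d i) = 1" for i
    using complex_norm_square[of "d i"] d[of i] by (simp_all add: mult.commute)
  then have "diagonal d \<in> unitary_group"
    by (simp add: unitary_group_def vec_eq_iff diagonal_mult_nth mult_diagonal_nth)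
       (simp add: diagonal_def mat_def)
  then show ?thesis
    using V by (simp add: conjugate_diagonal_def unitary_mult adjoint_unitary)
qed

lemma norm_conjugate_diagonal_displacement:
  assumes V: "V \<in> unitary_group" and d: "\<And>i. cmod (d i - 1) \<le> t"
  shows "norm (conjugate_diagonal V d *v y - y) \<le> t * norm y"
proof -
  define w where "w = adjoint_matrix V *v y"
  have "0 \<le> t" using d norm_ge_zero order_trans by blast
  have y: "y = V *v w" and w: "norm w = norm y"
    using V adjoint_unitary[OF V]
    by (simp_all add: w_def matrix_vector_mul_assoc unitary_group_def norm_unitary_mult_vec)
  have "conjugate_diagonal V d *v y = V *v (diagonal d *v w)"
    by (simp add: conjugate_diagonal_def w_def matrix_vector_mul_assoc matrix_mul_assoc)
  then have "conjugate_diagonal V d *v y - y = V *v (diagonal d *v w - w)"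
    by (simp only: y matrix_vector_mult_diff_distrib)
  then have "norm (conjugate_diagonal V d *v y - y) = norm (diagonal d *v w - w)"
    using V by (simp add: norm_unitary_mult_vec)
  also have "\<dots> \<le> L2_set (\<lambda>i. t * norm (w $ i)) UNIV"
    unfolding norm_vec_def
  proof (intro L2_set_mono)
    fix i
    have "(diagonal d *v w) $ i = d i * w $ i"
      by (simp add: diagonal_def matrix_vector_mult_def if_distrib[of "\<lambda>x. x * _"] cong: if_cong)
    then have "(diagonal d *v w - w) $ i = (d i - 1) * w $ i"
      by (simp add: algebra_simps)
    then show "norm ((diagonal d *v w - w) $ i) \<le> t * norm (w $ i)"
      using d[of i] by (simp add: norm_mult mult_right_mono)
  qed simp
  also have "\<dots> = t * norm y"
    using \<open>0 \<le> t\<close> unfolding w[symmetric] by (simp add: norm_vec_def L2_set_right_distrib)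
  finally show ?thesis .
qed

section \<open>Shrinking and unwinding the unitary group\<close>

lemma cmod_cis_diff: "cmod (cis a - cis b) = 2 * \<bar>sin ((a - b) / 2)\<bar>"
proof -
  have "sin ((b - a) / 2) = - sin ((a - b) / 2)"
    by (metis minus_diff_eq minus_divide_left sin_minus)
  then have "cos a - cos b = - (2 * sin ((a - b) / 2) * sin ((a + b) / 2))"
    "sin a - sin b = 2 * sin ((a - b) / 2) * cos ((a + b) / 2)"
    by (simp_all add: cos_diff_cos sin_diff_sin)
  then have "(cmod (cis a - cis b))\<^sup>2
      = (2 * sin ((a - b) / 2))\<^sup>2 * ((sin ((a + b) / 2))\<^sup>2 + (cos ((a + b) / 2))\<^sup>2)"
    by (simp add: cmod_power2 power_mult_distrib distrib_left del: sin_cos_squared_add sin_cos_squared_add2)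
  also have "\<dots> = (2 * \<bar>sin ((a - b) / 2)\<bar>)\<^sup>2"
    by (simp add: power_mult_distrib)
  finally show ?thesis by (rule power2_eq_imp_eq) simp_all
qed

text \<open>By concavity, \<open>sin\<close> lies above its chords through the origin on \<open>[0, \<pi>]\<close>.\<close>

lemma abs_sin_scale_ge:
  fixes x c :: real
  assumes "\<bar>x\<bar> \<le> pi" "0 \<le> c" "c \<le> 1"
  shows "c * \<bar>sin x\<bar> \<le> \<bar>sin (c * x)\<bar>"
proof -
  have "concave_on {0..pi} sin"
    by (rule f''_le0_imp_concave[where f' = cos and f'' = "\<lambda>x. - sin x"])
       (auto intro!: derivative_eq_intros sin_ge_zero)
  from concave_onD[OF this assms(2,3), of 0 "\<bar>x\<bar>"]
  have "c * sin \<bar>x\<bar> \<le> sin (c * \<bar>x\<bar>)" using assms by simp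
  moreover have "0 \<le> sin \<bar>x\<bar>" using assms by (intro sin_ge_zero) auto
  ultimately show ?thesis by (cases "x \<ge> 0") auto
qed

lemma cmod_cis_diff_le: "cmod (cis a - cis b) \<le> \<bar>a - b\<bar>"
  using abs_sin_x_le_abs_x[of "(a - b) / 2"] by (simp add: cmod_cis_diff)

text \<open>Multiplying arguments in \<open>[-\<pi>, \<pi>]\<close> by \<open>c\<close> shrinks chords of the unit circle by no more than
the factor \<open>c\<close>. Points on either side of the cut at \<open>-1\<close> are torn apart, which does no harm: only a
lower bound is needed.\<close>

lemma cmod_cis_scale_diff_ge:
  assumes "\<bar>a\<bar> \<le> pi" "\<bar>b\<bar> \<le> pi" "0 \<le> c" "c \<le> 1"
  shows "c * cmod (cis a - cis b) \<le> cmod (cis (c * a) - cis (c * b))"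
proof -
  have "\<bar>(a - b) / 2\<bar> \<le> pi" using assms by (simp add: abs_le_iff)
  from abs_sin_scale_ge[OF this assms(3,4)] show ?thesis
    by (simp add: cmod_cis_diff right_diff_distrib)
qed

lemma spectral_choice:
  obtains V :: "complex^'n^'n \<Rightarrow> complex^'n^'n" and \<theta> :: "complex^'n^'n \<Rightarrow> 'n \<Rightarrow> real"
  where "\<And>U. U \<in> unitary_group \<Longrightarrow> V U \<in> unitary_group"
    "\<And>U i. U \<in> unitary_group \<Longrightarrow> \<bar>\<theta> U i\<bar> \<le> pi"
    "\<And>U. U \<in> unitary_group \<Longrightarrow> conjugate_diagonal (V U) (\<lambda>i. cis (\<theta> U i)) = U"
proof -
  have "\<exists>p. fst p \<in> unitary_group \<and> (\<forall>i. \<bar>snd p i\<bar> \<le> pi) \<and>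
      conjugate_diagonal (fst p) (\<lambda>i. cis (snd p i)) = U"
    if "U \<in> unitary_group" for U :: "complex^'n^'n"
    using unitary_spectral[OF that] by (metis fst_conv snd_conv)
  then obtain p where p: "\<And>U :: complex^'n^'n. U \<in> unitary_group \<Longrightarrow>
      fst (p U) \<in> unitary_group \<and> (\<forall>i. \<bar>snd (p U) i\<bar> \<le> pi) \<and>
      conjugate_diagonal (fst (p U)) (\<lambda>i. cis (snd (p U) i)) = U"
    by metis
  show ?thesis
    by (rule that[of "\<lambda>U. fst (p U)" "\<lambda>U. snd (p U)"]) (use p in auto)
qed

text \<open>The map \<open>g\<close> sends \<open>V diag(cis \<theta>) V\<^sup>*\<close> to \<open>V diag(cis (c \<theta>)) V\<^sup>*\<close> with \<open>|\<theta>| \<le> \<pi>\<close>. It squeezes the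
whole unitary group into a neighbourhood of the identity of radius \<open>\<pi> c\<close> in the operator norm,
while Frobenius distances lose at most the factor \<open>c\<close>. Both \<open>V\<close> and \<open>\<theta>\<close> are
chosen arbitrarily, and \<open>g\<close> is discontinuous in general.\<close>

lemma unitary_shrinking:
  fixes c :: real
  assumes c: "0 \<le> c" "c \<le> 1"
  obtains g :: "complex^'n^'n \<Rightarrow> complex^'n^'n"
  where "\<And>U. U \<in> unitary_group \<Longrightarrow> g U \<in> unitary_group"
    "\<And>U W. U \<in> unitary_group \<Longrightarrow> W \<in> unitary_group \<Longrightarrow> c * norm (U - W) \<le> norm (g U - g W)"
    "\<And>U y. U \<in> unitary_group \<Longrightarrow> norm (g U *v y - y) \<le> (pi * c) * norm y"
proof -
  obtain V :: "complex^'n^'n \<Rightarrow> complex^'n^'n" and \<theta> :: "complex^'n^'n \<Rightarrow> 'n \<Rightarrow> real"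
    where V: "\<And>U. U \<in> unitary_group \<Longrightarrow> V U \<in> unitary_group"
      and \<theta>: "\<And>U i. U \<in> unitary_group \<Longrightarrow> \<bar>\<theta> U i\<bar> \<le> pi"
      and U: "\<And>U. U \<in> unitary_group \<Longrightarrow> conjugate_diagonal (V U) (\<lambda>i. cis (\<theta> U i)) = U"
    by (rule spectral_choice) blast
  define g where "g U = conjugate_diagonal (V U) (\<lambda>i. cis (c * \<theta> U i))" for U
  show ?thesis
  proof (rule that[of g])
    fix U W :: "complex^'n^'n" and y
    assume *: "U \<in> unitary_group"
    show "g U \<in> unitary_group"
      unfolding g_def by (intro conjugate_diagonal_unitary V *) simp
    have "cmod (cis (c * \<theta> U i) - 1) \<le> pi * c" for i
    proof -
      have "cmod (cis (c * \<theta> U i) - 1) \<le> c * \<bar>\<theta> U i\<bar>"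
        using cmod_cis_diff_le[of "c * \<theta> U i" 0] c by (simp add: abs_mult)
      also have "\<dots> \<le> pi * c"
        using mult_left_mono[OF \<theta>[OF *] c(1)] by (simp add: mult.commute)
      finally show ?thesis .
    qed
    then show "norm (g U *v y - y) \<le> (pi * c) * norm y"
      unfolding g_def by (intro norm_conjugate_diagonal_displacement V *)
    assume **: "W \<in> unitary_group"
    have "c * norm (conjugate_diagonal (V U) (\<lambda>i. cis (\<theta> U i)) -
          conjugate_diagonal (V W) (\<lambda>i. cis (\<theta> W i))) \<le> norm (g U - g W)"
      unfolding g_def
      by (intro norm_conjugate_diagonal_diff_mono cmod_cis_scale_diff_ge V \<theta> c * **)
    then show "c * norm (U - W) \<le> norm (g U - g W)"
      by (simp only: U * **)
  qed
qed

text \<open>The map \<open>V diag(cis \<theta>) V\<^sup>* \<mapsto> V diag(\<theta>) V\<^sup>*\<close> does not decrease Frobenius distances, as arcs are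
at least as long as their chords. It transfers packings of the unitary group to a bounded set
in the real vector space of Hermitian matrices, which has dimension \<open>n\<^sup>2\<close> and not \<open>2 n\<^sup>2\<close>.\<close>

lemma hermitian_logarithm:
  obtains h :: "complex^'n^'n \<Rightarrow> complex^'n^'n"
  where "\<And>U. U \<in> unitary_group \<Longrightarrow> adjoint_matrix (h U) = h U"
    "\<And>U. U \<in> unitary_group \<Longrightarrow> norm (h U) \<le> pi * real CARD('n)"
    "\<And>U W. U \<in> unitary_group \<Longrightarrow> W \<in> unitary_group \<Longrightarrow> norm (U - W) \<le> norm (h U - h W)"
proof -
  obtain V :: "complex^'n^'n \<Rightarrow> complex^'n^'n" and \<theta> :: "complex^'n^'n \<Rightarrow> 'n \<Rightarrow> real"
    where V: "\<And>U. U \<in> unitary_group \<Longrightarrow> V U \<in> unitary_group"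
      and \<theta>: "\<And>U i. U \<in> unitary_group \<Longrightarrow> \<bar>\<theta> U i\<bar> \<le> pi"
      and U: "\<And>U. U \<in> unitary_group \<Longrightarrow> conjugate_diagonal (V U) (\<lambda>i. cis (\<theta> U i)) = U"
    by (rule spectral_choice) blast
  define h where "h U = conjugate_diagonal (V U) (\<lambda>i. complex_of_real (\<theta> U i))" for U
  show ?thesis
  proof (rule that[of h])
    fix U W :: "complex^'n^'n"
    assume *: "U \<in> unitary_group"
    have "adjoint_matrix (diagonal (\<lambda>i. complex_of_real (\<theta> U i)))
        = diagonal (\<lambda>i. complex_of_real (\<theta> U i))"
      by (simp add: vec_eq_iff diagonal_def)
    then show "adjoint_matrix (h U) = h U"
      by (simp add: h_def conjugate_diagonal_def adjoint_matrix_mult matrix_mul_assoc)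
    have "(norm (h U))\<^sup>2 = (norm (diagonal (\<lambda>i. complex_of_real (\<theta> U i))))\<^sup>2"
      using V[OF *] adjoint_unitary[OF V[OF *]]
      by (simp add: h_def conjugate_diagonal_def norm_unitary_mult_left norm_unitary_mult_right)
    also have "\<dots> = (\<Sum>i\<in>UNIV. (\<theta> U i)\<^sup>2)"
      by (simp add: norm_matrix_squared diagonal_def if_distrib[of cmod] if_distrib[of "\<lambda>x. x\<^sup>2"]
          cong: if_cong)
    also have "\<dots> \<le> (\<Sum>i\<in>(UNIV :: 'n set). pi\<^sup>2)"
      using \<theta>[OF *] by (intro sum_mono) (metis abs_ge_zero power2_abs power_mono)
    also have "\<dots> = real CARD('n) * pi\<^sup>2" by simp
    also have "\<dots> \<le> (real CARD('n))\<^sup>2 * pi\<^sup>2"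
      using zero_less_card_finite[where 'a='n]
      by (intro mult_right_mono self_le_power) simp_all
    also have "\<dots> = (pi * real CARD('n))\<^sup>2" by (simp add: power_mult_distrib)
    finally show "norm (h U) \<le> pi * real CARD('n)"
      by (rule power2_le_imp_le) simp
    assume **: "W \<in> unitary_group"
    have "1 * norm (conjugate_diagonal (V U) (\<lambda>i. cis (\<theta> U i)) -
          conjugate_diagonal (V W) (\<lambda>i. cis (\<theta> W i))) \<le> norm (h U - h W)"
      unfolding h_def using cmod_cis_diff_le
      by (intro norm_conjugate_diagonal_diff_mono V * **) (simp_all flip: of_real_diff)
    then show "norm (U - W) \<le> norm (h U - h W)"
      by (simp only: U * ** mult_1)
  qed
qed

section \<open>Packing bound\<close>

text \<open>The \<open>n\<^sup>2\<close> real numbers \<open>Re K\<^sub>i\<^sub>j + Im K\<^sub>i\<^sub>j\<close> are isometric coordinates on the Hermitian matrices: the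
real part is symmetric and the imaginary part antisymmetric, so that the mixed terms
\<open>2 Re K\<^sub>i\<^sub>j Im K\<^sub>i\<^sub>j\<close> cancel in the sum of squares.\<close>

lemma hermitian_large_coordinate:
  fixes K :: "complex^'n^'n"
  assumes K: "adjoint_matrix K = K" and \<epsilon>: "\<epsilon> \<le> norm K"
  obtains i j where "\<epsilon> / real CARD('n) \<le> \<bar>Re (K $ i $ j) + Im (K $ i $ j)\<bar>"
proof (rule ccontr)
  assume "\<not> thesis"
  then have less: "\<bar>Re (K $ i $ j) + Im (K $ i $ j)\<bar> < \<epsilon> / real CARD('n)" for i j
    using that not_le by blast
  have sym: "Re (K $ i $ j) = Re (K $ j $ i)" "Im (K $ i $ j) = - Im (K $ j $ i)" for i j
    using arg_cong[OF K, of "\<lambda>A. A $ i $ j"] by (simp_all add: complex_eq_iff)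
  have skew: "Re (K $ j $ i) * Im (K $ j $ i) = - (Re (K $ i $ j) * Im (K $ i $ j))" for i j
    using sym[of i j] by simp
  define X where "X = (\<Sum>i\<in>UNIV. \<Sum>j\<in>UNIV. Re (K $ i $ j) * Im (K $ i $ j))"
  have "X = (\<Sum>i\<in>UNIV. \<Sum>j\<in>UNIV. Re (K $ j $ i) * Im (K $ j $ i))"
    unfolding X_def by (rule sum.swap)
  also have "\<dots> = (\<Sum>i\<in>UNIV. \<Sum>j\<in>UNIV. - (Re (K $ i $ j) * Im (K $ i $ j)))"
    by (intro sum.cong refl skew)
  also have "\<dots> = - X"
    by (simp add: X_def sum_negf)
  finally have "X = 0" by simp
  have "(norm K)\<^sup>2 = (norm K)\<^sup>2 + 2 * X"
    by (simp add: \<open>X = 0\<close>)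
  also have "\<dots> = (\<Sum>i\<in>UNIV. \<Sum>j\<in>UNIV. (Re (K $ i $ j) + Im (K $ i $ j))\<^sup>2)"
    by (simp add: norm_matrix_squared X_def sum_distrib_left cmod_power2 power2_sum
        flip: sum.distrib) (simp add: mult.assoc)
  also have "\<dots> < (\<Sum>i\<in>(UNIV :: 'n set). \<Sum>j\<in>(UNIV :: 'n set). (\<epsilon> / real CARD('n))\<^sup>2)"
    using less
    by (intro sum_strict_mono) (auto intro!: power2_strict_mono less_le_trans[OF _ abs_ge_self])
  also have "\<dots> = \<epsilon>\<^sup>2"
    by (simp add: power2_eq_square)
  finally have "(norm K)\<^sup>2 < \<epsilon>\<^sup>2" .
  moreover have "0 < \<epsilon> / real CARD('n)"
    using less[of undefined undefined] abs_ge_zero le_less_trans by blast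
  then have "0 \<le> \<epsilon>" by (simp add: zero_less_divide_iff)
  ultimately have "norm K < \<epsilon>" by (rule power2_less_imp_less)
  then show False using \<epsilon> by simp
qed

text \<open>Points whose coordinates differ by at least \<open>s\<close> somewhere lie in different cells of the grid
of mesh \<open>s\<close>.\<close>

lemma card_separated_le:
  fixes f :: "'a \<Rightarrow> 'i::finite \<Rightarrow> real"
  assumes "0 < s" and R: "\<And>x i. x \<in> E \<Longrightarrow> \<bar>f x i\<bar> \<le> R"
    and sep: "\<And>x y. x \<in> E \<Longrightarrow> y \<in> E \<Longrightarrow> x \<noteq> y \<Longrightarrow> \<exists>i. s \<le> \<bar>f x i - f y i\<bar>"
    and "0 \<le> R"
  shows "real (card E) \<le> (2 * R / s + 2) ^ CARD('i)"
proof -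
  define F where "F x i = \<lfloor>f x i / s\<rfloor>" for x i
  define B where "B = {\<lfloor>- R / s\<rfloor>..\<lfloor>R / s\<rfloor>}"
  have "inj_on F E"
  proof (rule inj_onI, rule ccontr)
    fix x y assume xy: "x \<in> E" "y \<in> E" "F x = F y" "x \<noteq> y"
    then obtain i where i: "s \<le> \<bar>f x i - f y i\<bar>" using sep by blast
    have "\<lfloor>f x i / s\<rfloor> = \<lfloor>f y i / s\<rfloor>" using fun_cong[OF xy(3), of i] by (simp add: F_def)
    then have "\<bar>f x i / s - f y i / s\<bar> < 1" by linarith
    moreover have "\<bar>f x i / s - f y i / s\<bar> = \<bar>f x i - f y i\<bar> / s"
      using \<open>0 < s\<close> by (simp flip: diff_divide_distrib add: abs_divide)
    ultimately show False using i \<open>0 < s\<close> by (simp add: divide_less_eq)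
  qed
  moreover have "F x i \<in> B" if "x \<in> E" for x i
  proof -
    have "- R / s \<le> f x i / s" "f x i / s \<le> R / s"
      using R[OF that, of i] \<open>0 < s\<close> by (simp_all add: field_simps abs_le_iff)
    then show ?thesis by (simp add: F_def B_def floor_mono)
  qed
  then have "F ` E \<subseteq> (UNIV :: 'i set) \<rightarrow>\<^sub>E B" by auto
  moreover have "finite ((UNIV :: 'i set) \<rightarrow>\<^sub>E B)"
    by (intro finite_PiE) (simp_all add: B_def)
  ultimately have "card E \<le> card ((UNIV :: 'i set) \<rightarrow>\<^sub>E B)"
    by (rule card_inj_on_le)
  also have "\<dots> = card B ^ CARD('i)"
    by (rule card_funcsetE) simp
  finally have "card E \<le> card B ^ CARD('i)" .
  then have "real (card E) \<le> real (card B) ^ CARD('i)"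
    by (simp flip: of_nat_power)
  also have "real (card B) \<le> 2 * R / s + 2"
  proof -
    have "0 \<le> R / s" using assms by simp
    then show ?thesis unfolding B_def by simp linarith
  qed
  then have "real (card B) ^ CARD('i) \<le> (2 * R / s + 2) ^ CARD('i)"
    by (intro power_mono) simp_all
  finally show ?thesis .
qed

text \<open>The exponent \<open>n\<^sup>2\<close> is what matters; the constant disappears in the iteration below.\<close>

lemma card_separated_unitary_le:
  fixes E :: "(complex^'n^'n) set"
  assumes E: "E \<subseteq> unitary_group" and \<epsilon>: "0 < \<epsilon>" "\<epsilon> \<le> 1"
    and sep: "\<And>U W. U \<in> E \<Longrightarrow> W \<in> E \<Longrightarrow> U \<noteq> W \<Longrightarrow> \<epsilon> \<le> norm (U - W)"
  shows "real (card E) \<le> ((4 * pi * (real CARD('n))\<^sup>2 + 2) / \<epsilon>) ^ (CARD('n))\<^sup>2"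
proof -
  let ?n = "real CARD('n)"
  obtain h :: "complex^'n^'n \<Rightarrow> complex^'n^'n"
    where h_adj: "\<And>U. U \<in> unitary_group \<Longrightarrow> adjoint_matrix (h U) = h U"
      and h_norm: "\<And>U. U \<in> unitary_group \<Longrightarrow> norm (h U) \<le> pi * ?n"
      and h_diff: "\<And>U W. U \<in> unitary_group \<Longrightarrow> W \<in> unitary_group \<Longrightarrow>
        norm (U - W) \<le> norm (h U - h W)"
    by (rule hermitian_logarithm) blast
  define f where "f U = (\<lambda>(i, j). Re (h U $ i $ j) + Im (h U $ i $ j))" for U
  have "real (card E) \<le> (2 * (2 * (pi * ?n)) / (\<epsilon> / ?n) + 2) ^ CARD('n \<times> 'n)"
  proof (rule card_separated_le[where f = f])
    fix U and ij :: "'n \<times> 'n" assume "U \<in> E"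
    obtain i j where ij: "ij = (i, j)" by (cases ij)
    have "\<bar>f U ij\<bar> \<le> 2 * cmod (h U $ i $ j)"
      using abs_Re_le_cmod[of "h U $ i $ j"] abs_Im_le_cmod[of "h U $ i $ j"]
      by (simp add: f_def ij)
    also have "\<dots> \<le> 2 * norm (h U)"
      using Finite_Cartesian_Product.norm_nth_le[where x = "h U $ i" and i = j] Finite_Cartesian_Product.norm_nth_le[where x = "h U" and i = i] by simp
    also have "\<dots> \<le> 2 * (pi * ?n)"
      using h_norm E \<open>U \<in> E\<close> by auto
    finally show "\<bar>f U ij\<bar> \<le> 2 * (pi * ?n)" .
  next
    fix U W assume "U \<in> E" "W \<in> E" "U \<noteq> W"
    then have UW: "U \<in> unitary_group" "W \<in> unitary_group" using E by auto
    have "adjoint_matrix (h U - h W) = adjoint_matrix (h U) - adjoint_matrix (h W)"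
      by (simp add: vec_eq_iff)
    then have "adjoint_matrix (h U - h W) = h U - h W"
      by (simp add: h_adj UW)
    moreover have "\<epsilon> \<le> norm (h U - h W)"
      using sep[OF \<open>U \<in> E\<close> \<open>W \<in> E\<close> \<open>U \<noteq> W\<close>] h_diff[OF UW] by simp
    ultimately obtain i j
      where "\<epsilon> / ?n \<le> \<bar>Re ((h U - h W) $ i $ j) + Im ((h U - h W) $ i $ j)\<bar>"
      by (rule hermitian_large_coordinate)
    then show "\<exists>ij. \<epsilon> / ?n \<le> \<bar>f U ij - f W ij\<bar>"
      by (intro exI[of _ "(i, j)"]) (simp add: f_def algebra_simps)
  qed (use \<epsilon> in simp_all)
  also have "\<dots> \<le> ((4 * pi * ?n\<^sup>2 + 2) / \<epsilon>) ^ CARD('n \<times> 'n)"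
    using \<epsilon> by (intro power_mono) (simp_all add: field_simps power2_eq_square)
  finally show ?thesis by (simp add: power2_eq_square)
qed

section \<open>Multiplying separated sets\<close>

lemma matrix_inv_unitary:
  assumes "B \<in> unitary_group"
  shows "matrix_inv B = adjoint_matrix B"
proof -
  have "B ** adjoint_matrix B = mat 1 \<and> adjoint_matrix B ** B = mat 1"
    using assms by (simp add: unitary_group_def)
  then have "B ** matrix_inv B = mat 1 \<and> matrix_inv B ** B = mat 1"
    unfolding matrix_inv_def by (rule someI)
  then have "matrix_inv B = matrix_inv B ** (B ** adjoint_matrix B)"
    using assms by (simp add: unitary_group_def)
  also have "\<dots> = adjoint_matrix B"
    using \<open>B ** matrix_inv B = mat 1 \<and> _\<close> by (simp add: matrix_mul_assoc)
  finally show ?thesis .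
qed

text \<open>With \<open>y = B\<^sup>-\<^sup>1 x\<close> the displacement of \<open>A B\<^sup>-\<^sup>1\<close> at \<open>x\<close> is \<open>A y - B y\<close>. Replacing \<open>A y\<close> by
\<open>A G y\<close> and \<open>B y\<close> by \<open>B H y\<close> costs at most \<open>t\<close> each, and the Frobenius norm dominates the operator
norm. So translates by \<open>A\<close> and \<open>B\<close> of a small neighbourhood of the identity remain far apart.\<close>

lemma phi_quotient_le:
  fixes A B G H :: "complex^'n^'n"
  assumes A: "A \<in> unitary_group" and B: "B \<in> unitary_group"
    and G: "\<And>y. norm (G *v y - y) \<le> t * norm y" and H: "\<And>y. norm (H *v y - y) \<le> t * norm y"
  shows "phi (A ** matrix_inv B) \<le> norm (A ** G - B ** H) + 2 * t"
  unfolding phi_def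
proof (rule cSUP_least)
  show "sphere (0 :: complex^'n) 1 \<noteq> {}" by simp
next
  fix x :: "complex^'n"
  assume "x \<in> sphere 0 1"
  define y where "y = adjoint_matrix B *v x"
  have y: "norm y = 1" "B *v y = x"
    using B adjoint_unitary[OF B] \<open>x \<in> sphere 0 1\<close>
    by (simp_all add: y_def matrix_vector_mul_assoc unitary_group_def norm_unitary_mult_vec)
  have "(A ** matrix_inv B) *v x - x = A *v y - B *v y"
    unfolding y(2) by (simp add: y_def matrix_inv_unitary[OF B] matrix_vector_mul_assoc)
  also have "\<dots> = (A ** G - B ** H) *v y - A *v (G *v y - y) + B *v (H *v y - y)"
    by (simp add: matrix_vector_mult_diff_rdistrib matrix_vector_mult_diff_distrib
        matrix_vector_mul_assoc)
  finally have "norm ((A ** matrix_inv B) *v x - x)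
      \<le> norm ((A ** G - B ** H) *v y) + norm (A *v (G *v y - y)) + norm (B *v (H *v y - y))"
    by (simp only:) (rule order_trans[OF norm_triangle_ineq add_right_mono[OF norm_triangle_ineq4]])
  also have "\<dots> \<le> norm (A ** G - B ** H) + t + t"
    using norm_matrix_mult_vec_le[of "A ** G - B ** H" y] G[of y] H[of y] y(1)
    by (simp add: norm_unitary_mult_vec A B)
  finally show "norm ((A ** matrix_inv B) *v x - x) \<le> norm (A ** G - B ** H) + 2 * t"
    by simp
qed

text \<open>From a separated set \<open>E\<close> one obtains the \<open>|S|\<close> times larger set of all \<open>A g(U)\<close> with \<open>A \<in> S\<close>
and \<open>U \<in> E\<close>. Products with the same \<open>A\<close> are separated because \<open>g\<close> shrinks
distances by at most the factor \<open>c\<close>; products with different \<open>A\<close> are separated by \<open>\<eta>\<close> because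
the factors \<open>g(U)\<close> are within \<open>\<pi> c\<close> of the identity.\<close>

lemma separated_products:
  fixes S :: "(complex^'n^'n) set"
  assumes S: "S \<subseteq> unitary_group" and c: "0 < c" "c \<le> 1" and "0 < \<eta>"
    and sep: "\<And>A B. A \<in> S \<Longrightarrow> B \<in> S \<Longrightarrow> A \<noteq> B \<Longrightarrow> 2 * pi * c + \<eta> \<le> phi (A ** matrix_inv B)"
  shows "\<exists>E :: (complex^'n^'n) set. E \<subseteq> unitary_group \<and> card E = card S ^ k \<and>
    (\<forall>U\<in>E. \<forall>W\<in>E. U \<noteq> W \<longrightarrow> \<eta> * c ^ k \<le> norm (U - W))"
proof (induction k)
  case 0
  have "(mat 1 :: complex^'n^'n) \<in> unitary_group"
    by (simp add: unitary_group_def) (simp add: vec_eq_iff mat_def)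
  then show ?case by (intro exI[of _ "{mat 1}"]) simp
next
  case (Suc k)
  then obtain E :: "(complex^'n^'n) set" where E: "E \<subseteq> unitary_group" "card E = card S ^ k"
    "\<And>U W. U \<in> E \<Longrightarrow> W \<in> E \<Longrightarrow> U \<noteq> W \<Longrightarrow> \<eta> * c ^ k \<le> norm (U - W)"
    by blast
  obtain g :: "complex^'n^'n \<Rightarrow> complex^'n^'n"
    where g: "\<And>U. U \<in> unitary_group \<Longrightarrow> g U \<in> unitary_group"
      and g_diff: "\<And>U W. U \<in> unitary_group \<Longrightarrow> W \<in> unitary_group \<Longrightarrow>
        c * norm (U - W) \<le> norm (g U - g W)"
      and g_near: "\<And>U y. U \<in> unitary_group \<Longrightarrow> norm (g U *v y - y) \<le> (pi * c) * norm y"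
    by (rule unitary_shrinking[OF less_imp_le[OF c(1)] c(2)]) blast
  define m where "m = (\<lambda>(A :: complex^'n^'n, U). A ** g U)"
  have far: "\<eta> * c ^ Suc k \<le> norm (m p - m q)" if pq: "p \<in> S \<times> E" "q \<in> S \<times> E" "p \<noteq> q" for p q
  proof -
    obtain A U B W where p: "p = (A, U)" and q: "q = (B, W)" by (cases p, cases q)
    have mem: "A \<in> S" "B \<in> S" "U \<in> E" "W \<in> E"
      "A \<in> unitary_group" "B \<in> unitary_group" "U \<in> unitary_group" "W \<in> unitary_group"
      using pq S E p q by auto
    show ?thesis
    proof (cases "A = B")
      case True
      then have "U \<noteq> W" using pq p q by simp
      have "\<eta> * c ^ Suc k \<le> c * norm (U - W)"
        using mult_left_mono[OF E(3)[OF mem(3,4) \<open>U \<noteq> W\<close>], of c] c by (simp add: mult_ac)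
      also have "\<dots> \<le> norm (g U - g W)"
        by (rule g_diff[OF mem(7,8)])
      also have "\<dots> = norm (A ** (g U - g W))"
        by (simp add: norm_unitary_mult_left mem)
      also have "A ** (g U - g W) = m p - m q"
        by (simp add: m_def p q True vec_eq_iff matrix_matrix_mult_def algebra_simps sum_subtractf)
      finally show ?thesis .
    next
      case False
      have "2 * pi * c + \<eta> \<le> norm (m p - m q) + 2 * (pi * c)"
        using sep[OF mem(1,2) False] phi_quotient_le[OF mem(5,6) g_near[OF mem(7)] g_near[OF mem(8)]]
        by (simp add: m_def p q)
      moreover have "\<eta> * c ^ Suc k \<le> \<eta> * 1"
        using c \<open>0 < \<eta>\<close> by (intro mult_left_mono power_le_one) simp_all
      ultimately show ?thesis by simp
    qed
  qed
  have "inj_on m (S \<times> E)"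
  proof (rule inj_onI, rule ccontr)
    fix p q assume "p \<in> S \<times> E" "q \<in> S \<times> E" "m p = m q" "p \<noteq> q"
    then have "\<eta> * c ^ Suc k \<le> 0" using far[of p q] by simp
    moreover have "0 < \<eta> * c ^ Suc k" using c \<open>0 < \<eta>\<close> by simp
    ultimately show False by linarith
  qed
  then have "card (m ` (S \<times> E)) = card S ^ Suc k"
    by (simp add: card_image card_cartesian_product E)
  moreover have "m ` (S \<times> E) \<subseteq> unitary_group"
    using S E g by (auto simp: m_def intro!: unitary_mult)
  moreover have "\<eta> * c ^ Suc k \<le> norm (U - W)"
    if "U \<in> m ` (S \<times> E)" "W \<in> m ` (S \<times> E)" "U \<noteq> W" for U W
    using that far by blast
  ultimately show ?case by blast
qed

text \<open>The \<open>k\<close>-th set of the preceding lemma has \<open>|S|\<^sup>k\<close> points with separation \<open>\<eta> c\<^sup>k\<close>, and the packing bound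
allows only a constant times \<open>c\<close> to the power \<open>- k n\<^sup>2\<close>. Comparing growth rates as \<open>k\<close> increases removes the
constant.\<close>

lemma card_mult_power_le_1:
  fixes S :: "(complex^'n^'n) set"
  assumes S: "S \<subseteq> unitary_group" and c: "0 < c" "c \<le> 1" and "0 < \<eta>"
    and sep: "\<And>A B. A \<in> S \<Longrightarrow> B \<in> S \<Longrightarrow> A \<noteq> B \<Longrightarrow> 2 * pi * c + \<eta> \<le> phi (A ** matrix_inv B)"
  shows "real (card S) * c ^ (CARD('n))\<^sup>2 \<le> 1"
proof (rule ccontr)
  let ?N = "(CARD('n))\<^sup>2" and ?C = "4 * pi * (real CARD('n))\<^sup>2 + 2"
  assume "\<not> ?thesis"
  then obtain k where k: "(?C / min \<eta> 1) ^ ?N < (real (card S) * c ^ ?N) ^ k"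
    using real_arch_pow[of "real (card S) * c ^ ?N"] by fastforce
  \<comment> \<open>The packing bound is for separations of at most \<open>1\<close>.\<close>
  have "min \<eta> 1 > 0" "min \<eta> 1 \<le> 1" using \<open>0 < \<eta>\<close> by auto
  have "2 * pi * c + min \<eta> 1 \<le> phi (A ** matrix_inv B)" if "A \<in> S" "B \<in> S" "A \<noteq> B" for A B
    using sep[OF that] by simp
  from separated_products[OF S c \<open>min \<eta> 1 > 0\<close> this, where k = k]
  obtain E :: "(complex^'n^'n) set" where E: "E \<subseteq> unitary_group" "card E = card S ^ k"
    "\<And>U W. U \<in> E \<Longrightarrow> W \<in> E \<Longrightarrow> U \<noteq> W \<Longrightarrow> min \<eta> 1 * c ^ k \<le> norm (U - W)"
    by blast
  have "0 < min \<eta> 1 * c ^ k" "min \<eta> 1 * c ^ k \<le> 1"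
    using c \<open>min \<eta> 1 > 0\<close> by (auto intro!: mult_le_one power_le_one)
  from card_separated_unitary_le[OF E(1) this E(3)]
  have "real (card S) ^ k \<le> (?C / (min \<eta> 1 * c ^ k)) ^ ?N"
    by (simp add: E(2))
  also have "\<dots> = (?C / min \<eta> 1) ^ ?N / (c ^ ?N) ^ k"
  proof -
    have "(c ^ k) ^ ?N = (c ^ ?N) ^ k" by (metis mult.commute power_mult)
    then show ?thesis by (simp only: divide_divide_eq_left[symmetric] power_divide)
  qed
  finally have "(real (card S) * c ^ ?N) ^ k \<le> (?C / min \<eta> 1) ^ ?N"
    using c by (simp add: pos_le_divide_eq power_mult_distrib)
  with k show False by linarith
qed

theorem theorem1:
  fixes S :: "(complex^'n^'n) set"
  assumes "S \<subseteq> unitary_group" and "finite S" and "card S \<ge> 2"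
  shows "min_separation S \<le> 2 * pi * real (card S) powr (- 1 / (real CARD('n))\<^sup>2)"
proof (rule ccontr)
  let ?N = "(CARD('n))\<^sup>2"
  \<comment> \<open>The value of \<open>c\<close> for which \<open>|S|\<close> times the \<open>n\<^sup>2\<close>-th power of \<open>c\<close> is exactly \<open>1\<close>; any larger one
    with \<open>2 \<pi> c\<close> below the minimal separation contradicts the preceding lemma.\<close>
  define c0 where "c0 = real (card S) powr (- 1 / real ?N)"
  assume "\<not> ?thesis"
  then have "c0 < min_separation S / (2 * pi)"
    by (simp add: c0_def pos_less_divide_eq mult.commute not_le)
  moreover have "c0 < 1"
    unfolding c0_def using assms(3) by (subst powr_less_one) auto
  ultimately obtain c where c: "c0 < c" "c < 1" "c < min_separation S / (2 * pi)"
    using dense[of c0 "min 1 (min_separation S / (2 * pi))"] by auto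
  have "0 < c0" using assms(3) by (simp add: c0_def)
  have "min_separation S \<le> phi (A ** matrix_inv B)" if "A \<in> S" "B \<in> S" "A \<noteq> B" for A B
    unfolding min_separation_def
  proof (rule Min_le)
    have "{phi (A ** matrix_inv B) | A B. A \<in> S \<and> B \<in> S \<and> A \<noteq> B}
        \<subseteq> (\<lambda>(A, B). phi (A ** matrix_inv B)) ` (S \<times> S)" by auto
    then show "finite {phi (A ** matrix_inv B) | A B. A \<in> S \<and> B \<in> S \<and> A \<noteq> B}"
      by (rule finite_subset) (simp add: assms(2))
  qed (use that in blast)
  then have "real (card S) * c ^ ?N \<le> 1"
    using c \<open>0 < c0\<close> assms
    by (intro card_mult_power_le_1[where \<eta> = "min_separation S - 2 * pi * c"])
       (simp_all add: field_simps)
  moreover have "real (card S) * c0 ^ ?N = 1"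
  proof -
    have "c0 ^ ?N = c0 powr real ?N"
      using \<open>0 < c0\<close> by (rule powr_realpow[symmetric])
    also have "\<dots> = real (card S) powr (- 1 / real ?N * real ?N)"
      unfolding c0_def by (rule powr_powr)
    also have "\<dots> = 1 / real (card S)"
      using assms(3) by (simp add: powr_minus_divide)
    finally show ?thesis using assms(3) by simp
  qed
  moreover have "real (card S) * c0 ^ ?N < real (card S) * c ^ ?N"
    using c \<open>0 < c0\<close> assms(3) by (intro mult_strict_left_mono power_strict_mono) auto
  ultimately show False by linarith
qed

end
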